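(* A finite graded poset $P$ is both $(3+1)$-avoiding and $(2+2)$-avoiding if and only if: (1) $P$ grade-avoids $2[0]+2[0]$, i.e., there are no two elements $a,c$ of some rank $i$ and two elements $b,d$ of rank $i+1$ with $a<b$, $c<d$, $a\not<d$, $c\not<b$; (2) every vertex of $P$ is up-seeing or down-seeing (or both); (3) every rank of $P$ contains at least one all-seeing vertex.
   Context: A finite poset is graded if all maximal chains have the same number of elements; then each element has a rank (minimal elements rank $0$, covering increases rank by $1$), and $P(i)$ is the set of elements of rank $i$. $P$ contains $(a_1+\cdots+a_m)$ if there are pairwise disjoint chains $C_1,\dots,C_m$ with $|C_i|=a_i$ such that elements in different chains are incomparable; otherwise it avoids it. For $p\in P(i)$, $US(p)$ is the set of elements covering $p$ and $DS(p)$ the set of elements covered by $p$; $p$ is up-seeing if $US(p)=P(i+1)$, down-seeing if $DS(p)=P(i-1)$ (with $P(j)=\emptyset$ for ranks outside the range), and all-seeing if both. *)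

theory Defs
  imports Main
begin

text \<open>
  A finite poset is a finite carrier \<open>P\<close> together with its (reflexive) order relation \<open>r\<close>,
  subject to \<^term>\<open>partial_order_on P r\<close>, which includes \<^prop>\<open>r \<subseteq> P \<times> P\<close>.
\<close>

definition lt :: "'a rel \<Rightarrow> 'a \<Rightarrow> 'a \<Rightarrow> bool" where
  "lt r x y \<longleftrightarrow> (x, y) \<in> r \<and> x \<noteq> y"

definition incomparable :: "'a rel \<Rightarrow> 'a \<Rightarrow> 'a \<Rightarrow> bool" where
  "incomparable r x y \<longleftrightarrow> (x, y) \<notin> r \<and> (y, x) \<notin> r"

definition covers :: "'a rel \<Rightarrow> 'a \<Rightarrow> 'a \<Rightarrow> bool" where
  "covers r y x \<longleftrightarrow> lt r x y \<and> (\<nexists>z. lt r x z \<and> lt r z y)"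

definition minimal_in :: "'a set \<Rightarrow> 'a rel \<Rightarrow> 'a \<Rightarrow> bool" where
  "minimal_in P r x \<longleftrightarrow> x \<in> P \<and> (\<nexists>y. lt r y x)"

definition graded :: "'a set \<Rightarrow> 'a rel \<Rightarrow> bool" where
  "graded P r \<longleftrightarrow>
     (\<forall>C D. pred_on.maxchain P (lt r) C \<longrightarrow> pred_on.maxchain P (lt r) D \<longrightarrow> card C = card D)"

text \<open>
  The value 0 off the carrier only serves to make the rank function unique as a total function.
  For a finite graded poset it exists and is unique: see \<open>is_rank_function_poset_rank\<close> and
  \<open>is_rank_function_unique\<close>.
\<close>

definition is_rank_function :: "'a set \<Rightarrow> 'a rel \<Rightarrow> ('a \<Rightarrow> nat) \<Rightarrow> bool" where
  "is_rank_function P r \<rho> \<longleftrightarrow>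
     (\<forall>x. minimal_in P r x \<longrightarrow> \<rho> x = 0) \<and>
     (\<forall>x y. covers r y x \<longrightarrow> \<rho> y = \<rho> x + 1) \<and>
     (\<forall>x. x \<notin> P \<longrightarrow> \<rho> x = 0)"

definition poset_rank :: "'a set \<Rightarrow> 'a rel \<Rightarrow> 'a \<Rightarrow> nat" where
  "poset_rank P r = (THE \<rho>. is_rank_function P r \<rho>)"

text \<open>Ranks are indexed by integers, so that \<^term>\<open>P(-1)\<close> is the empty set.\<close>

definition rank_set :: "'a set \<Rightarrow> 'a rel \<Rightarrow> int \<Rightarrow> 'a set" where
  "rank_set P r i = {x \<in> P. int (poset_rank P r x) = i}"

definition US :: "'a rel \<Rightarrow> 'a \<Rightarrow> 'a set" where
  "US r p = {q. covers r q p}"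

definition DS :: "'a rel \<Rightarrow> 'a \<Rightarrow> 'a set" where
  "DS r p = {q. covers r p q}"

definition up_seeing :: "'a set \<Rightarrow> 'a rel \<Rightarrow> 'a \<Rightarrow> bool" where
  "up_seeing P r p \<longleftrightarrow> US r p = rank_set P r (int (poset_rank P r p) + 1)"

definition down_seeing :: "'a set \<Rightarrow> 'a rel \<Rightarrow> 'a \<Rightarrow> bool" where
  "down_seeing P r p \<longleftrightarrow> DS r p = rank_set P r (int (poset_rank P r p) - 1)"

definition all_seeing :: "'a set \<Rightarrow> 'a rel \<Rightarrow> 'a \<Rightarrow> bool" where
  "all_seeing P r p \<longleftrightarrow> up_seeing P r p \<and> down_seeing P r p"

text \<open>The list \<open>as = [a\<^sub>1, \<dots>, a\<^sub>m]\<close> stands for the poset \<open>(a\<^sub>1 + \<dots> + a\<^sub>m)\<close>.\<close>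

definition contains_chain_sum :: "'a set \<Rightarrow> 'a rel \<Rightarrow> nat list \<Rightarrow> bool" where
  "contains_chain_sum P r as \<longleftrightarrow>
     (\<exists>C :: nat \<Rightarrow> 'a set.
        (\<forall>i < length as. pred_on.chain P (lt r) (C i) \<and> card (C i) = as ! i) \<and>
        (\<forall>i < length as. \<forall>j < length as. i \<noteq> j \<longrightarrow>
           C i \<inter> C j = {} \<and> (\<forall>x \<in> C i. \<forall>y \<in> C j. incomparable r x y)))"

definition avoids_chain_sum :: "'a set \<Rightarrow> 'a rel \<Rightarrow> nat list \<Rightarrow> bool" where
  "avoids_chain_sum P r as \<longleftrightarrow> \<not> contains_chain_sum P r as"

definition grade_avoids_2_0_plus_2_0 :: "'a set \<Rightarrow> 'a rel \<Rightarrow> bool" where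
  "grade_avoids_2_0_plus_2_0 P r \<longleftrightarrow>
     \<not> (\<exists>i. \<exists>a \<in> rank_set P r i. \<exists>c \<in> rank_set P r i.
          \<exists>b \<in> rank_set P r (i + 1). \<exists>d \<in> rank_set P r (i + 1).
            lt r a b \<and> lt r c d \<and> \<not> lt r a d \<and> \<not> lt r c b)"

subsection \<open>The rank function is well defined\<close>

lemma chain_iff:
  "pred_on.chain P (lt r) C \<longleftrightarrow> C \<subseteq> P \<and> (\<forall>x\<in>C. \<forall>y\<in>C. x = y \<or> (x, y) \<in> r \<or> (y, x) \<in> r)"
  unfolding pred_on.chain_def lt_def by auto

lemma maxchain_iff:
  "pred_on.maxchain P (lt r) C \<longleftrightarrow> pred_on.chain P (lt r) C \<and>
     (\<forall>z \<in> P. (\<forall>x\<in>C. x = z \<or> (x, z) \<in> r \<or> (z, x) \<in> r) \<longrightarrow> z \<in> C)" (is "?L \<longleftrightarrow> ?R")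
proof
  assume L: ?L
  then have C: "pred_on.chain P (lt r) C"
    unfolding pred_on.maxchain_def by blast
  have "z \<in> C" if "z \<in> P" and "\<forall>x\<in>C. x = z \<or> (x, z) \<in> r \<or> (z, x) \<in> r" for z
  proof (rule ccontr)
    assume "z \<notin> C"
    moreover have "pred_on.chain P (lt r) (insert z C)"
      using C that unfolding chain_iff by auto
    ultimately show False
      using L unfolding pred_on.maxchain_def by blast
  qed
  with C show ?R by blast
next
  assume R: ?R
  show ?L
    unfolding pred_on.maxchain_def
  proof (intro conjI notI)
    show "pred_on.chain P (lt r) C" using R by blast
    assume "\<exists>S. pred_on.chain P (lt r) S \<and> C \<subset> S"
    then obtain S z where S: "pred_on.chain P (lt r) S" "C \<subset> S" "z \<in> S" "z \<notin> C" by blast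
    then have "z \<in> P" "\<forall>x\<in>C. x = z \<or> (x, z) \<in> r \<or> (z, x) \<in> r"
      unfolding chain_iff by blast+
    with R S(4) show False by blast
  qed
qed

lemma ex_maxchain_superset:
  assumes "finite Q" and "pred_on.chain Q (lt r) C"
  shows "\<exists>M. C \<subseteq> M \<and> pred_on.maxchain Q (lt r) M"
proof -
  have "finite {D. pred_on.chain Q (lt r) D}"
    by (rule finite_subset[of _ "Pow Q"]) (use assms in \<open>auto simp: chain_iff\<close>)
  then obtain M where "C \<subseteq> M" "pred_on.chain Q (lt r) M"
    "\<forall>D. pred_on.chain Q (lt r) D \<longrightarrow> M \<subseteq> D \<longrightarrow> M = D"
    using finite_has_maximal2[of "{D. pred_on.chain Q (lt r) D}" C] assms(2) by auto
  then show ?thesis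
    unfolding pred_on.maxchain_def by blast
qed

context
  fixes P :: "'a set" and r :: "'a rel"
  assumes fin: "finite P" and po: "partial_order_on P r"
begin

private lemma rsub: "(x, y) \<in> r \<Longrightarrow> x \<in> P \<and> y \<in> P"
  using po unfolding partial_order_on_def preorder_on_def by blast
private lemma rrefl: "x \<in> P \<Longrightarrow> (x, x) \<in> r"
  using po unfolding partial_order_on_def preorder_on_def refl_on_def by blast
private lemma rtrans: "(x, y) \<in> r \<Longrightarrow> (y, z) \<in> r \<Longrightarrow> (x, z) \<in> r"
  using po unfolding partial_order_on_def preorder_on_def by (blast dest: transD)
private lemma rantisym: "(x, y) \<in> r \<Longrightarrow> (y, x) \<in> r \<Longrightarrow> x = y"
  using po unfolding partial_order_on_def by (blast dest: antisymD)

private definition dn where "dn x = {z. (z, x) \<in> r}"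
private definition up where "up x = {z. (x, z) \<in> r}"

private lemma finite_dn: "finite (dn x)" and finite_up: "finite (up x)"
  using fin rsub unfolding dn_def up_def by (auto intro: rev_finite_subset)

private lemma maxchain_dn_mem: "x \<in> P \<Longrightarrow> pred_on.maxchain (dn x) (lt r) C \<Longrightarrow> x \<in> C"
  unfolding maxchain_iff chain_iff dn_def using rrefl by blast
private lemma maxchain_up_mem: "x \<in> P \<Longrightarrow> pred_on.maxchain (up x) (lt r) C \<Longrightarrow> x \<in> C"
  unfolding maxchain_iff chain_iff up_def using rrefl by blast

private lemma glue:
  assumes C: "pred_on.maxchain (dn x) (lt r) C" and U: "pred_on.maxchain (up y) (lt r) U"
    and xy: "x = y \<and> x \<in> P \<or> covers r y x"
  shows "pred_on.maxchain P (lt r) (C \<union> U)"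
proof -
  have le: "(x, y) \<in> r" using xy rrefl unfolding covers_def lt_def by blast
  then have PP: "x \<in> P" "y \<in> P" using rsub by blast+
  have mem: "x \<in> C" "y \<in> U"
    using maxchain_dn_mem maxchain_up_mem C U PP by blast+
  have Csub: "C \<subseteq> dn x" and Usub: "U \<subseteq> up y"
    using C U unfolding maxchain_iff chain_iff by blast+
  have CU: "(u, v) \<in> r" if "u \<in> C" "v \<in> U" for u v
    using that Csub Usub le rtrans unfolding dn_def up_def by blast
  have "pred_on.chain P (lt r) (C \<union> U)"
    unfolding chain_iff
  proof (intro conjI ballI)
    show "C \<union> U \<subseteq> P" using Csub Usub rsub unfolding dn_def up_def by blast
    fix u v assume uv: "u \<in> C \<union> U" "v \<in> C \<union> U"
    consider "u \<in> C" "v \<in> C" | "u \<in> U" "v \<in> U" | "u \<in> C" "v \<in> U" | "u \<in> U" "v \<in> C"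
      using uv by blast
    then show "u = v \<or> (u, v) \<in> r \<or> (v, u) \<in> r"
      using C U CU unfolding maxchain_iff chain_iff by cases blast+
  qed
  moreover have "z \<in> C \<union> U"
    if z: "z \<in> P" and zc: "\<forall>w\<in>C \<union> U. w = z \<or> (w, z) \<in> r \<or> (z, w) \<in> r" for z
  proof -
    have "z \<in> dn x \<or> z \<in> up y"
    proof (rule ccontr)
      assume n: "\<not> ?thesis"
      then have "z \<noteq> x" "z \<noteq> y" using rrefl[OF PP(1)] rrefl[OF PP(2)] unfolding dn_def up_def by auto
      with zc mem have "(z, x) \<in> r \<or> (x, z) \<in> r" "(z, y) \<in> r \<or> (y, z) \<in> r" by (metis UnI1 UnI2)+
      with n have "lt r x z" "lt r z y"
        using \<open>z \<noteq> x\<close> \<open>z \<noteq> y\<close> unfolding dn_def up_def lt_def by blast+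
      moreover from this have "x \<noteq> y" using rantisym unfolding lt_def by blast
      ultimately show False using xy unfolding covers_def by blast
    qed
    then show ?thesis
      using C U zc unfolding maxchain_iff by blast
  qed
  ultimately show ?thesis unfolding maxchain_iff by blast
qed

lemma ex_is_rank_function:
  assumes "graded P r"
  shows "\<exists>\<rho>. is_rank_function P r \<rho>"
proof -
  define Cd where "Cd x = (SOME C. pred_on.maxchain (dn x) (lt r) C)" for x
  define Cu where "Cu x = (SOME C. pred_on.maxchain (up x) (lt r) C)" for x
  have Cd: "pred_on.maxchain (dn x) (lt r) (Cd x)" for x
    unfolding Cd_def
    by (rule someI_ex) (use ex_maxchain_superset[OF finite_dn, where C = "{}" and r = r] in
        \<open>auto simp: chain_iff\<close>)
  have Cu: "pred_on.maxchain (up x) (lt r) (Cu x)" for x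
    unfolding Cu_def
    by (rule someI_ex) (use ex_maxchain_superset[OF finite_up, where C = "{}" and r = r] in
        \<open>auto simp: chain_iff\<close>)
  have finC: "finite (Cd x)" "finite (Cu x)" for x
    using Cd[of x] Cu[of x] finite_dn[of x] finite_up[of x]
    unfolding maxchain_iff chain_iff by (auto intro: finite_subset)
  have subC: "Cd x \<subseteq> dn x" "Cu x \<subseteq> up x" for x
    using Cd[of x] Cu[of x] unfolding maxchain_iff chain_iff by auto
  define \<rho> where "\<rho> x = card (Cd x) - 1" for x
  have "\<rho> x = 0" if "minimal_in P r x" for x
  proof -
    have "Cd x \<subseteq> {x}"
      using that subC[of x] unfolding minimal_in_def lt_def dn_def by blast
    then have "card (Cd x) \<le> 1"
      using card_mono[of "{x}" "Cd x"] by simp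
    then show ?thesis unfolding \<rho>_def by simp
  qed
  moreover have "\<rho> x = 0" if "x \<notin> P" for x
  proof -
    have "Cd x = {}" using that subC[of x] rsub unfolding dn_def by blast
    then show ?thesis unfolding \<rho>_def by simp
  qed
  moreover have "\<rho> y = \<rho> x + 1" if c: "covers r y x" for x y
  proof -
    have xy: "(x, y) \<in> r" "x \<noteq> y" and P: "x \<in> P" "y \<in> P"
      using c rsub unfolding covers_def lt_def by blast+
    have "card (Cd x \<union> Cu y) = card (Cd y \<union> Cu y)"
      using glue[OF Cd Cu, of x y] glue[OF Cd Cu, of y y] c P assms
      unfolding graded_def by blast
    moreover have "card (Cd x \<union> Cu y) = card (Cd x) + card (Cu y)"
    proof (rule card_Un_disjoint[OF finC])
      show "Cd x \<inter> Cu y = {}"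
        using subC[of x] subC[of y] xy rtrans rantisym unfolding dn_def up_def by blast
    qed
    moreover have "Cd y \<inter> Cu y = {y}"
      using subC[of y] rantisym maxchain_dn_mem[OF P(2) Cd] maxchain_up_mem[OF P(2) Cu]
      unfolding dn_def up_def by blast
    then have "card (Cd y \<union> Cu y) + 1 = card (Cd y) + card (Cu y)"
      using card_Un_Int[OF finC, of y y] by simp
    moreover have "card (Cd x) > 0"
      using maxchain_dn_mem[OF P(1) Cd] finC(1) card_gt_0_iff by blast
    ultimately show ?thesis unfolding \<rho>_def by linarith
  qed
  ultimately show ?thesis unfolding is_rank_function_def by blast
qed

lemma is_rank_function_unique:
  assumes f: "is_rank_function P r f" and g: "is_rank_function P r g"
  shows "f = g"
proof
  fix x
  show "f x = g x"
  proof (induction "card (dn x)" arbitrary: x rule: less_induct)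
    case less
    show ?case
    proof (cases "x \<in> P \<and> \<not> minimal_in P r x")
      case False
      then show ?thesis using f g unfolding is_rank_function_def by auto
    next
      case True
      then obtain y where y: "lt r y x" unfolding minimal_in_def by blast
      define A where "A = {z. lt r z x}"
      have "A \<subseteq> dn x" unfolding A_def dn_def lt_def by blast
      then have A: "finite A" using finite_dn finite_subset by blast
      let ?I = "(\<lambda>w. card (dn w)) ` A"
      have "finite ?I" "?I \<noteq> {}" using A y unfolding A_def by auto
      then have "Max ?I \<in> ?I" by (rule Max_in)
      then obtain z where "z \<in> A" "Max ?I = card (dn z)" by blast
      with \<open>finite ?I\<close> have z: "z \<in> A" "\<forall>w\<in>A. card (dn w) \<le> card (dn z)"
        using Max_ge[of ?I] by fastforce+
      have less_card: "card (dn v) < card (dn w)" if "lt r v w" for v w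
      proof (rule psubset_card_mono[OF finite_dn])
        show "dn v \<subset> dn w"
        proof
          show "dn v \<subseteq> dn w" using that rtrans unfolding lt_def dn_def by blast
          have "w \<in> dn w" "w \<notin> dn v"
            using that rsub[of v w] rrefl[of w] rantisym[of v w] unfolding lt_def dn_def by auto
          then show "dn v \<noteq> dn w" by blast
        qed
      qed
      have "covers r x z"
        unfolding covers_def
      proof (intro conjI notI)
        show "lt r z x" using z(1) unfolding A_def by simp
        assume "\<exists>w. lt r z w \<and> lt r w x"
        then obtain w where w: "lt r z w" "lt r w x" by blast
        then have "card (dn w) \<le> card (dn z)" using z(2) unfolding A_def by blast
        with less_card[OF w(1)] show False by simp
      qed
      moreover have "f z = g z"
        using less[OF less_card] z(1) unfolding A_def by blast
      ultimately show ?thesis using f g unfolding is_rank_function_def by simp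
    qed
  qed
qed

lemma is_rank_function_poset_rank:
  assumes "graded P r"
  shows "is_rank_function P r (poset_rank P r)"
proof -
  obtain \<rho> where "is_rank_function P r \<rho>" using ex_is_rank_function[OF assms] by blast
  then show ?thesis
    using theI[of "is_rank_function P r", OF _ is_rank_function_unique]
    unfolding poset_rank_def by blast
qed

end

end

theory Submission
  imports Defs
begin

text \<open>
  If every nonempty rank has an all-seeing vertex, then elements whose ranks differ by at least 2
  are comparable, so a copy of \<open>(3 + 1)\<close> or \<open>(2 + 2)\<close> is confined to consecutive ranks, where
  conditions (2) and (1) exclude it. Conversely, (1) says that the sets \<^term>\<open>US r p\<close>, for \<open>p\<close> of a
  fixed rank, form a chain under inclusion, and likewise the sets \<^term>\<open>DS r p\<close>. Hence each rank has
  up-seeing and down-seeing vertices. Take an up-seeing \<open>p\<close> with largest \<^term>\<open>DS r p\<close> and a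
  down-seeing \<open>q\<close> with largest \<^term>\<open>US r q\<close>. If neither is all-seeing, then some \<open>s < q\<close> and
  \<open>t > p\<close> have \<open>s \<not>< p\<close> and \<open>q \<not>< t\<close>, and \<open>s < q\<close>, \<open>p < t\<close> form a \<open>(2 + 2)\<close>: an element strictly
  between \<open>s\<close> and \<open>t\<close> would contradict (2) and the choice of \<open>p\<close> and \<open>q\<close>.
\<close>

locale finite_graded_poset =
  fixes P :: "'a set" and r :: "'a rel"
  assumes fin: "finite P" and po: "partial_order_on P r" and gr: "graded P r"
begin

abbreviation less (infix "\<sqsubset>" 50) where "x \<sqsubset> y \<equiv> lt r x y"
abbreviation "rk \<equiv> poset_rank P r"

section \<open>Strict order, covers and rank\<close>

lemma less_in: "x \<sqsubset> y \<Longrightarrow> x \<in> P" "x \<sqsubset> y \<Longrightarrow> y \<in> P"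
  using po unfolding partial_order_on_def preorder_on_def lt_def by blast+

lemma less_trans: "x \<sqsubset> y \<Longrightarrow> y \<sqsubset> z \<Longrightarrow> x \<sqsubset> z"
  using po unfolding partial_order_on_def preorder_on_def lt_def
  by (blast dest: transD antisymD)

lemma incomparable_iff:
  assumes "x \<in> P"
  shows "incomparable r x y \<longleftrightarrow> x \<noteq> y \<and> \<not> x \<sqsubset> y \<and> \<not> y \<sqsubset> x"
  using assms po unfolding partial_order_on_def preorder_on_def refl_on_def incomparable_def lt_def
  by blast

lemma rank_cover: "covers r y x \<Longrightarrow> rk y = rk x + 1"
  and rank_minimal: "minimal_in P r x \<Longrightarrow> rk x = 0"
  using is_rank_function_poset_rank[OF fin po gr] unfolding is_rank_function_def by blast+

lemma finite_less: "finite {z. z \<sqsubset> y}" "finite {z. x \<sqsubset> z}"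
  using fin less_in by (auto intro: rev_finite_subset)

text \<open>Supplies the measures for induction along the order: the number of elements strictly
  below or strictly above.\<close>

lemma card_less_mono:
  assumes "x \<sqsubset> y"
  shows "card {z. z \<sqsubset> x} < card {z. z \<sqsubset> y}" "card {z. y \<sqsubset> z} < card {z. x \<sqsubset> z}"
proof -
  have irrefl: "\<not> z \<sqsubset> z" for z unfolding lt_def by blast
  have "{z. z \<sqsubset> x} \<subset> {z. z \<sqsubset> y}" "{z. y \<sqsubset> z} \<subset> {z. x \<sqsubset> z}"
    using assms less_trans irrefl by blast+
  then show "card {z. z \<sqsubset> x} < card {z. z \<sqsubset> y}" "card {z. y \<sqsubset> z} < card {z. x \<sqsubset> z}"
    by (simp_all add: psubset_card_mono finite_less)
qed

text \<open>If \<open>y\<close> does not cover \<open>x\<close>, replacing \<open>y\<close> by an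
  element strictly between lowers the number of elements below it, so this descent ends at a
  cover.\<close>

lemma ex_cover_above:
  assumes "x \<sqsubset> y"
  shows "\<exists>m. covers r m x \<and> (m = y \<or> m \<sqsubset> y)"
  using assms
proof (induction "card {z. z \<sqsubset> y}" arbitrary: y rule: less_induct)
  case less
  show ?case
  proof (cases "covers r y x")
    case False
    then obtain z where z: "x \<sqsubset> z" "z \<sqsubset> y" using less.prems unfolding covers_def by blast
    from less.hyps[OF card_less_mono(1)[OF z(2)] z(1)] z(2) show ?thesis using less_trans by blast
  qed blast
qed

lemma ex_cover_below:
  assumes "x \<sqsubset> y"
  shows "\<exists>m. covers r y m \<and> (m = x \<or> x \<sqsubset> m)"
  using assms
proof (induction "card {z. x \<sqsubset> z}" arbitrary: x rule: less_induct)
  case less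
  show ?case
  proof (cases "covers r y x")
    case False
    then obtain z where z: "x \<sqsubset> z" "z \<sqsubset> y" using less.prems unfolding covers_def by blast
    from less.hyps[OF card_less_mono(2)[OF z(1)] z(2)] z(1) show ?thesis using less_trans by blast
  qed blast
qed

lemma rank_less: "x \<sqsubset> y \<Longrightarrow> rk x < rk y"
proof (induction "card {z. x \<sqsubset> z}" arbitrary: x rule: less_induct)
  case less
  obtain m where m: "covers r m x" "m = y \<or> m \<sqsubset> y" using ex_cover_above[OF less.prems] by blast
  show ?case
  proof (cases "m = y")
    case False
    have "x \<sqsubset> m" using m(1) unfolding covers_def by blast
    from less.hyps[OF card_less_mono(2)[OF this]] False m(2) rank_cover[OF m(1)] show ?thesis by simp
  qed (use rank_cover m in simp)
qed

text \<open>An element strictly between would need a rank strictly between consecutive naturals.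
  Covering thereby becomes a condition on ranks.\<close>

lemma covers_iff: "covers r y x \<longleftrightarrow> x \<sqsubset> y \<and> rk y = rk x + 1"
proof
  assume a: "x \<sqsubset> y \<and> rk y = rk x + 1"
  then show "covers r y x"
    unfolding covers_def using rank_less[of x] rank_less[of _ y] by fastforce
qed (use rank_cover covers_def in metis)

lemma ex_between:
  assumes "x \<sqsubset> y" "rk x + 1 < rk y"
  obtains m where "x \<sqsubset> m" "m \<sqsubset> y" "rk m = rk x + 1"
  using ex_cover_above[OF assms(1)] assms(2) unfolding covers_iff by auto

text \<open>An element of positive rank is not minimal, so it covers an element one rank lower;
  repeating this reaches rank \<open>i\<close>.\<close>

lemma ex_rank_below:
  assumes "y \<in> P" "i < rk y"
  shows "\<exists>x. x \<sqsubset> y \<and> rk x = i"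
  using assms
proof (induction "rk y" arbitrary: y)
  case (Suc n)
  then have "\<not> minimal_in P r y" using rank_minimal by force
  then obtain z where "z \<sqsubset> y" using Suc.prems unfolding minimal_in_def by blast
  then obtain m where m: "m \<sqsubset> y" "rk y = rk m + 1"
    using ex_cover_below unfolding covers_iff by blast
  show ?case
  proof (cases "i = rk m")
    case False
    then have "\<exists>x. x \<sqsubset> m \<and> rk x = i" using Suc m less_in by simp
    then show ?thesis using m less_trans by blast
  qed (use m in blast)
qed simp

lemma ex_chain_below:
  assumes "x \<in> P"
  shows "\<exists>C. pred_on.chain P (lt r) C \<and> card C = rk x + 1 \<and> (\<forall>z\<in>C. z = x \<or> z \<sqsubset> x)"
  using assms
proof (induction "rk x" arbitrary: x)
  case 0
  then show ?case by (intro exI[of _ "{x}"]) (auto simp: chain_iff)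
next
  case (Suc n)
  then obtain m where m: "m \<sqsubset> x" "rk m = n" using ex_rank_below[of x n] by auto
  then obtain C where C: "pred_on.chain P (lt r) C" "card C = n + 1" "\<forall>z\<in>C. z = m \<or> z \<sqsubset> m"
    using Suc.hyps(1) less_in by blast
  have below: "z \<sqsubset> x" if "z \<in> C" for z using C(3) that m(1) less_trans by metis
  then have "x \<notin> C" unfolding lt_def by blast
  moreover have "finite C" using C(2) by (intro card_ge_0_finite) simp
  ultimately have "card (insert x C) = rk x + 1" using C(2) Suc.hyps(2) by simp
  moreover have "pred_on.chain P (lt r) (insert x C)"
    using C(1) below Suc.prems unfolding chain_iff lt_def by blast
  ultimately show ?case using below by blast
qed

text \<open>Equal sizes of maximal chains enter here. Without a cover, \<open>x\<close> would be
  maximal, so a maximal chain through \<open>x\<close> would have at most \<open>rk x + 1\<close>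
  elements, whereas one extending a chain that descends from \<open>y\<close> has at least
  \<open>rk y + 1\<close>.\<close>

lemma ex_next_rank:
  assumes "x \<in> P" "y \<in> P" "rk x < rk y"
  shows "\<exists>z. x \<sqsubset> z \<and> rk z = rk x + 1"
proof (rule ccontr)
  assume no: "\<not> ?thesis"
  have max: "\<not> x \<sqsubset> z" for z using no ex_cover_above unfolding covers_iff by blast
  obtain M where M: "{x} \<subseteq> M" "pred_on.maxchain P (lt r) M"
    using ex_maxchain_superset[OF fin, of r "{x}"] assms(1) by (auto simp: chain_iff)
  obtain C where C: "pred_on.chain P (lt r) C" "card C = rk y + 1"
    using ex_chain_below[OF assms(2)] by blast
  obtain N where N: "C \<subseteq> N" "pred_on.maxchain P (lt r) N"
    using ex_maxchain_superset[OF fin C(1)] by blast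
  have comp: "u = v \<or> u \<sqsubset> v \<or> v \<sqsubset> u" if "u \<in> M" "v \<in> M" for u v
    using M(2) that unfolding maxchain_iff chain_iff lt_def by blast
  \<comment> \<open>Distinct elements of a chain have distinct ranks, and maximality of
    \<open>x\<close> bounds these ranks by \<open>rk x\<close>.\<close>
  have "inj_on rk M" using comp rank_less by (metis inj_onI less_irrefl)
  moreover have "rk ` M \<subseteq> {..rk x}"
    using comp[of x] M(1) max rank_less by (fastforce intro: less_imp_le)
  ultimately have "card M \<le> rk x + 1" using card_inj_on_le[of rk M "{..rk x}"] by simp
  moreover have "finite N"
    using N(2) fin unfolding maxchain_iff chain_iff by (auto intro: finite_subset)
  then have "rk y + 1 \<le> card N" using N(1) C(2) card_mono by metis
  moreover have "card M = card N" using gr M(2) N(2) unfolding graded_def by blast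
  ultimately show False using assms(3) by simp
qed

section \<open>Elementwise forms of the definitions\<close>

lemma rank_set_of_nat: "x \<in> rank_set P r (int n) \<longleftrightarrow> x \<in> P \<and> rk x = n"
  unfolding rank_set_def by simp

lemma up_seeing_iff: "up_seeing P r p \<longleftrightarrow> (\<forall>q\<in>P. rk q = rk p + 1 \<longrightarrow> p \<sqsubset> q)"
  unfolding up_seeing_def US_def covers_iff rank_set_def using less_in by auto

text \<open>Writing \<open>rk p = rk q + 1\<close> avoids truncated subtraction: at rank 0 no
  \<open>q\<close> satisfies it, which matches the empty rank -1.\<close>

lemma down_seeing_iff: "down_seeing P r p \<longleftrightarrow> (\<forall>q\<in>P. rk p = rk q + 1 \<longrightarrow> q \<sqsubset> p)"
proof -
  have "int (rk q) = int (rk p) - 1 \<longleftrightarrow> rk p = rk q + 1" for q by linarith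
  then show ?thesis
    unfolding down_seeing_def DS_def covers_iff rank_set_def using less_in by auto
qed

lemma grade_avoids_iff:
  "grade_avoids_2_0_plus_2_0 P r \<longleftrightarrow>
    \<not> (\<exists>a b c d. rk a = rk c \<and> rk b = rk a + 1 \<and> rk d = rk a + 1 \<and>
        a \<sqsubset> b \<and> c \<sqsubset> d \<and> \<not> a \<sqsubset> d \<and> \<not> c \<sqsubset> b)"
proof -
  have "(\<exists>i. \<exists>a \<in> rank_set P r i. \<exists>c \<in> rank_set P r i.
          \<exists>b \<in> rank_set P r (i + 1). \<exists>d \<in> rank_set P r (i + 1).
            a \<sqsubset> b \<and> c \<sqsubset> d \<and> \<not> a \<sqsubset> d \<and> \<not> c \<sqsubset> b) \<longleftrightarrow>
      (\<exists>a b c d. rk a = rk c \<and> rk b = rk a + 1 \<and> rk d = rk a + 1 \<and>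
        a \<sqsubset> b \<and> c \<sqsubset> d \<and> \<not> a \<sqsubset> d \<and> \<not> c \<sqsubset> b)" (is "?L \<longleftrightarrow> ?R")
  proof
    assume ?L
    then obtain i a b c d where *: "a \<in> rank_set P r i" "c \<in> rank_set P r i"
      "b \<in> rank_set P r (i + 1)" "d \<in> rank_set P r (i + 1)"
      "a \<sqsubset> b" "c \<sqsubset> d" "\<not> a \<sqsubset> d" "\<not> c \<sqsubset> b" by blast
    then have "rk a = rk c" "rk b = rk a + 1" "rk d = rk a + 1" unfolding rank_set_def by auto
    with * show ?R by blast
  next
    assume ?R
    then obtain a b c d where *: "rk a = rk c" "rk b = rk a + 1" "rk d = rk a + 1"
      "a \<sqsubset> b" "c \<sqsubset> d" "\<not> a \<sqsubset> d" "\<not> c \<sqsubset> b" by blast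
    then have "a \<in> rank_set P r (int (rk a))" "c \<in> rank_set P r (int (rk a))"
      "b \<in> rank_set P r (int (rk a) + 1)" "d \<in> rank_set P r (int (rk a) + 1)"
      using less_in unfolding rank_set_def by auto
    with * show ?L by blast
  qed
  then show ?thesis unfolding grade_avoids_2_0_plus_2_0_def by blast
qed

lemma chain_card_2E:
  assumes "pred_on.chain P (lt r) C" "card C = 2"
  obtains a b where "a \<in> C" "b \<in> C" "a \<sqsubset> b"
  using assms unfolding chain_iff card_2_iff lt_def by (metis insertCI)

text \<open>Every orientation of the three pairs contains a directed path through all three
  elements.\<close>

lemma chain_card_3E:
  assumes C: "pred_on.chain P (lt r) C" "card C = 3"
  obtains a b c where "a \<in> C" "b \<in> C" "c \<in> C" "a \<sqsubset> b" "b \<sqsubset> c"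
proof -
  obtain x y z where xyz: "C = {x, y, z}" "x \<noteq> y" "y \<noteq> z" "x \<noteq> z"
    using C(2) unfolding card_3_iff by auto
  then have "x \<sqsubset> y \<or> y \<sqsubset> x" "y \<sqsubset> z \<or> z \<sqsubset> y" "x \<sqsubset> z \<or> z \<sqsubset> x"
    using C(1) unfolding chain_iff lt_def by auto
  then show thesis using that xyz(1) by (metis insertCI)
qed

text \<open>Disjointness is implicit on the right: elements of \<open>P\<close> are comparable to
  themselves by reflexivity, so incomparable ones are distinct.\<close>

lemma contains_3_1_iff:
  "contains_chain_sum P r [3, 1] \<longleftrightarrow>
    (\<exists>a b c d. a \<sqsubset> b \<and> b \<sqsubset> c \<and> d \<in> P \<and> (\<forall>x\<in>{a, b, c}. incomparable r x d))"
proof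
  assume "contains_chain_sum P r [3, 1]"
  then obtain C :: "nat \<Rightarrow> 'a set" where
    C: "pred_on.chain P (lt r) (C 0)" "card (C 0) = 3"
       "pred_on.chain P (lt r) (C 1)" "card (C 1) = 1"
       "\<forall>x\<in>C 0. \<forall>y\<in>C 1. incomparable r x y"
    unfolding contains_chain_sum_def by (auto simp: less_Suc_eq all_conj_distrib)
  obtain a b c where "a \<in> C 0" "b \<in> C 0" "c \<in> C 0" "a \<sqsubset> b" "b \<sqsubset> c"
    using chain_card_3E[OF C(1,2)] .
  moreover obtain d where "C 1 = {d}" using C(4) card_1_singletonE by metis
  ultimately show "\<exists>a b c d. a \<sqsubset> b \<and> b \<sqsubset> c \<and> d \<in> P \<and> (\<forall>x\<in>{a, b, c}. incomparable r x d)"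
    using C(3,5) unfolding chain_iff by blast
next
  assume "\<exists>a b c d. a \<sqsubset> b \<and> b \<sqsubset> c \<and> d \<in> P \<and> (\<forall>x\<in>{a, b, c}. incomparable r x d)"
  then obtain a b c d where *: "a \<sqsubset> b" "b \<sqsubset> c" "d \<in> P" "\<forall>x\<in>{a, b, c}. incomparable r x d"
    by blast
  have ac: "a \<sqsubset> c" using less_trans *(1,2) by blast
  have ne: "a \<noteq> b" "b \<noteq> c" "a \<noteq> c" using * ac unfolding lt_def by auto
  have in_P: "a \<in> P" "b \<in> P" "c \<in> P" using * less_in by blast+
  have "d \<notin> {a, b, c}" using * in_P incomparable_iff by blast
  then show "contains_chain_sum P r [3, 1]"
    unfolding contains_chain_sum_def
    using * ac ne in_P
    by (intro exI[of _ "\<lambda>i. if i = 0 then {a, b, c} else {d}"])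
      (auto simp: less_Suc_eq chain_iff lt_def incomparable_def)
qed

lemma contains_2_2_iff:
  "contains_chain_sum P r [2, 2] \<longleftrightarrow>
    (\<exists>a b c d. a \<sqsubset> b \<and> c \<sqsubset> d \<and> (\<forall>x\<in>{a, b}. \<forall>y\<in>{c, d}. incomparable r x y))"
proof
  assume "contains_chain_sum P r [2, 2]"
  then obtain C :: "nat \<Rightarrow> 'a set" where
    C: "pred_on.chain P (lt r) (C 0)" "card (C 0) = 2"
       "pred_on.chain P (lt r) (C 1)" "card (C 1) = 2"
       "\<forall>x\<in>C 0. \<forall>y\<in>C 1. incomparable r x y"
    unfolding contains_chain_sum_def by (auto simp: less_Suc_eq all_conj_distrib)
  obtain a b where "a \<in> C 0" "b \<in> C 0" "a \<sqsubset> b" using chain_card_2E[OF C(1,2)] .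
  moreover obtain c d where "c \<in> C 1" "d \<in> C 1" "c \<sqsubset> d" using chain_card_2E[OF C(3,4)] .
  ultimately show
    "\<exists>a b c d. a \<sqsubset> b \<and> c \<sqsubset> d \<and> (\<forall>x\<in>{a, b}. \<forall>y\<in>{c, d}. incomparable r x y)"
    using C(5) by blast
next
  assume "\<exists>a b c d. a \<sqsubset> b \<and> c \<sqsubset> d \<and> (\<forall>x\<in>{a, b}. \<forall>y\<in>{c, d}. incomparable r x y)"
  then obtain a b c d where *: "a \<sqsubset> b" "c \<sqsubset> d" "\<forall>x\<in>{a, b}. \<forall>y\<in>{c, d}. incomparable r x y"
    by blast
  have in_P: "a \<in> P" "b \<in> P" "c \<in> P" "d \<in> P" using * less_in by blast+
  have ne: "a \<noteq> b" "c \<noteq> d" using * unfolding lt_def by auto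
  have "{a, b} \<inter> {c, d} = {}" using * in_P incomparable_iff by blast
  then show "contains_chain_sum P r [2, 2]"
    unfolding contains_chain_sum_def
    using * ne in_P
    by (intro exI[of _ "\<lambda>i. if i = 0 then {a, b} else {c, d}"])
      (auto simp: less_Suc_eq chain_iff lt_def incomparable_def)
qed

section \<open>Comparability across a rank gap\<close>

lemma less_if_rank_gap:
  assumes all: "\<And>i. rank_set P r i \<noteq> {} \<Longrightarrow> \<exists>p \<in> rank_set P r i. all_seeing P r p"
    and xy: "x \<in> P" "y \<in> P" "rk x + 1 < rk y"
  shows "x \<sqsubset> y"
proof -
  \<comment> \<open>An all-seeing \<open>v\<close> one rank above \<open>x\<close> lies above
    \<open>x\<close> and below every element of the following rank, hence below
    \<open>y\<close>.\<close>
  have "rank_set P r (int (rk x + 1)) \<noteq> {}"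
    using ex_rank_below[OF xy(2,3)] less_in rank_set_of_nat by blast
  then obtain v where "v \<in> rank_set P r (int (rk x + 1))" and v: "all_seeing P r v"
    using all by blast
  then have v_rk: "v \<in> P" "rk v = rk x + 1" unfolding rank_set_of_nat by blast+
  have up: "v \<sqsubset> w" if "w \<in> P" "rk w = rk x + 2" for w
    using v v_rk that unfolding all_seeing_def up_seeing_iff by simp
  have "x \<sqsubset> v" using v v_rk xy(1) unfolding all_seeing_def down_seeing_iff by simp
  moreover have "v \<sqsubset> y"
  proof (cases "rk y = rk x + 2")
    case False
    then obtain w where "w \<sqsubset> y" "rk w = rk x + 2"
      using ex_rank_below[OF xy(2), of "rk x + 2"] xy(3) by auto
    then show ?thesis using up less_in less_trans by blast
  qed (use up xy in blast)
  ultimately show ?thesis by (rule less_trans)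
qed

section \<open>Nested neighbourhoods and vertices seeing one side\<close>

lemma US_chain:
  assumes "grade_avoids_2_0_plus_2_0 P r" "rk p = rk q"
  shows "US r p \<subseteq> US r q \<or> US r q \<subseteq> US r p"
proof (rule ccontr)
  assume "\<not> ?thesis"
  \<comment> \<open>Witnesses against both inclusions form, with \<open>p\<close> and
    \<open>q\<close>, exactly the excluded configuration.\<close>
  then obtain b d where "covers r b p" "\<not> covers r b q" "covers r d q" "\<not> covers r d p"
    unfolding US_def by blast
  then have "rk b = rk p + 1" "rk d = rk p + 1" "p \<sqsubset> b" "q \<sqsubset> d" "\<not> p \<sqsubset> d" "\<not> q \<sqsubset> b"
    using assms(2) unfolding covers_iff by auto
  then show False using assms unfolding grade_avoids_iff by blast
qed

lemma DS_chain:
  assumes "grade_avoids_2_0_plus_2_0 P r" "rk p = rk q"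
  shows "DS r p \<subseteq> DS r q \<or> DS r q \<subseteq> DS r p"
proof (rule ccontr)
  assume "\<not> ?thesis"
  then obtain a c where "covers r p a" "\<not> covers r q a" "covers r q c" "\<not> covers r p c"
    unfolding DS_def by blast
  then have "rk a = rk c" "rk p = rk a + 1" "rk q = rk a + 1"
    "a \<sqsubset> p" "c \<sqsubset> q" "\<not> a \<sqsubset> q" "\<not> c \<sqsubset> p"
    using assms(2) unfolding covers_iff by auto
  then show False using assms(1) unfolding grade_avoids_iff by blast
qed

text \<open>Pairwise comparability makes a maximal member of the finite image greatest.\<close>

lemma finite_chain_greatest:
  assumes "finite A" "A \<noteq> {}" "\<And>p q. p \<in> A \<Longrightarrow> q \<in> A \<Longrightarrow> F p \<subseteq> F q \<or> F q \<subseteq> F p"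
  obtains p where "p \<in> A" "\<And>q. q \<in> A \<Longrightarrow> F q \<subseteq> F p"
proof -
  obtain m where "m \<in> F ` A" "\<forall>b\<in>F ` A. m \<subseteq> b \<longrightarrow> b = m"
    using finite_has_maximal[of "F ` A"] assms(1,2) by auto
  then show thesis using that assms(3) by (metis imageE imageI subset_refl)
qed

text \<open>Take \<open>p\<close> with greatest \<open>US r p\<close> in its rank. Every
  \<open>t\<close> one rank higher covers some \<open>q\<close> in the rank of \<open>p\<close>, so
  it lies in \<open>US r q\<close> and hence in \<open>US r p\<close>.\<close>

lemma ex_up_seeing:
  assumes ga: "grade_avoids_2_0_plus_2_0 P r" and x: "x \<in> P"
  shows "\<exists>p\<in>P. rk p = rk x \<and> up_seeing P r p"
proof -
  let ?A = "{p \<in> P. rk p = rk x}"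
  obtain p where p: "p \<in> ?A" and max: "\<And>q. q \<in> ?A \<Longrightarrow> US r q \<subseteq> US r p"
    by (rule finite_chain_greatest[of ?A "US r"]) (use fin x US_chain[OF ga] in auto)
  have "p \<sqsubset> t" if t: "t \<in> P" "rk t = rk p + 1" for t
  proof -
    obtain q where q: "q \<sqsubset> t" "rk q = rk p" using ex_rank_below[of t "rk p"] t by auto
    then have "t \<in> US r q" using t unfolding US_def covers_iff by simp
    then have "t \<in> US r p" using max[of q] q p less_in by auto
    then show ?thesis unfolding US_def covers_iff by simp
  qed
  then show ?thesis using p unfolding up_seeing_iff by blast
qed

text \<open>Dual argument with the greatest \<open>DS r p\<close>; here \<open>ex_next_rank\<close>
  ensures that every element one rank lower is covered by something in this rank.\<close>

lemma ex_down_seeing: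
  assumes ga: "grade_avoids_2_0_plus_2_0 P r" and x: "x \<in> P"
  shows "\<exists>p\<in>P. rk p = rk x \<and> down_seeing P r p"
proof -
  let ?A = "{p \<in> P. rk p = rk x}"
  obtain p where p: "p \<in> ?A" and max: "\<And>q. q \<in> ?A \<Longrightarrow> DS r q \<subseteq> DS r p"
    by (rule finite_chain_greatest[of ?A "DS r"]) (use fin x DS_chain[OF ga] in auto)
  have "s \<sqsubset> p" if s: "s \<in> P" "rk p = rk s + 1" for s
  proof -
    obtain q where q: "s \<sqsubset> q" "rk q = rk p" using ex_next_rank[of s p] s p by auto
    then have "s \<in> DS r q" using s unfolding DS_def covers_iff by simp
    then have "s \<in> DS r p" using max[of q] q p less_in by auto
    then show ?thesis unfolding DS_def covers_iff by simp
  qed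
  then show ?thesis using p unfolding down_seeing_iff by blast
qed

section \<open>The three conditions imply avoidance\<close>

lemma avoids_if_conditions:
  assumes ga: "grade_avoids_2_0_plus_2_0 P r"
    and sees: "\<And>p. p \<in> P \<Longrightarrow> up_seeing P r p \<or> down_seeing P r p"
    and all: "\<And>i. rank_set P r i \<noteq> {} \<Longrightarrow> \<exists>p \<in> rank_set P r i. all_seeing P r p"
  shows "avoids_chain_sum P r [3, 1]" "avoids_chain_sum P r [2, 2]"
proof -
  have near: "rk x \<le> rk y + 1" "rk y \<le> rk x + 1"
    if "incomparable r x y" "x \<in> P" "y \<in> P" for x y
    using that less_if_rank_gap[OF all, of x y] less_if_rank_gap[OF all, of y x]
      incomparable_iff[of x y] by fastforce+
  show "avoids_chain_sum P r [3, 1]"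
    unfolding avoids_chain_sum_def contains_3_1_iff
  proof
    assume "\<exists>a b c d. a \<sqsubset> b \<and> b \<sqsubset> c \<and> d \<in> P \<and> (\<forall>x\<in>{a, b, c}. incomparable r x d)"
    then obtain a b c d where *: "a \<sqsubset> b" "b \<sqsubset> c" "d \<in> P"
      and inc: "incomparable r a d" "incomparable r c d" by blast
    then have in_P: "a \<in> P" "c \<in> P" using less_in by blast+
    \<comment> \<open>The ranks of \<open>a\<close> and \<open>c\<close> differ by at least 2, and
      \<open>d\<close> is within one rank of both, so it sits exactly halfway.\<close>
    have "rk d = rk a + 1" "rk c = rk d + 1"
      using near[OF inc(1) in_P(1) *(3)] near[OF inc(2) in_P(2) *(3)]
        rank_less[OF *(1)] rank_less[OF *(2)] by linarith+
    then have "a \<sqsubset> d \<or> d \<sqsubset> c"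
      using sees[OF *(3)] in_P unfolding up_seeing_iff down_seeing_iff by blast
    then show False using inc in_P incomparable_iff by blast
  qed
  show "avoids_chain_sum P r [2, 2]"
    unfolding avoids_chain_sum_def contains_2_2_iff
  proof
    assume "\<exists>a b c d. a \<sqsubset> b \<and> c \<sqsubset> d \<and> (\<forall>x\<in>{a, b}. \<forall>y\<in>{c, d}. incomparable r x y)"
    then obtain a b c d where *: "a \<sqsubset> b" "c \<sqsubset> d"
      and inc: "incomparable r a d" "incomparable r b c" by blast
    have in_P: "a \<in> P" "b \<in> P" "c \<in> P" "d \<in> P" using * less_in by blast+
    \<comment> \<open>The chains give \<open>rk a < rk b\<close> and \<open>rk c < rk d\<close>,
      while incomparability gives \<open>rk b \<le> rk c + 1\<close> and
      \<open>rk d \<le> rk a + 1\<close>; so all four are equalities up to the step of one.\<close>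
    have "rk a = rk c" "rk b = rk a + 1" "rk d = rk a + 1"
      using near[OF inc(1) in_P(1,4)] near[OF inc(2) in_P(2,3)]
        rank_less[OF *(1)] rank_less[OF *(2)] by linarith+
    moreover have "\<not> a \<sqsubset> d" "\<not> c \<sqsubset> b" using inc in_P incomparable_iff by blast+
    ultimately show False using ga * unfolding grade_avoids_iff by blast
  qed
qed

section \<open>Avoidance implies the three conditions\<close>

context
  assumes av31: "avoids_chain_sum P r [3, 1]" and av22: "avoids_chain_sum P r [2, 2]"
begin

text \<open>If \<open>s\<close> were not below \<open>t\<close>, the two pairs would form a (2 + 2):
  the hypotheses and the comparison of ranks rule out every other relation between them.\<close>

lemma no_2_2_across:
  assumes "s \<sqsubset> u" "p \<sqsubset> t" "rk u = rk p" "\<not> s \<sqsubset> p" "\<not> u \<sqsubset> t"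
  shows "s \<sqsubset> t"
proof (rule ccontr)
  assume st: "\<not> s \<sqsubset> t"
  have in_P: "s \<in> P" "u \<in> P" "p \<in> P" "t \<in> P" using assms less_in by blast+
  have rk: "rk s < rk u" "rk p < rk t" using assms(1,2) rank_less by blast+
  have "\<forall>x\<in>{s, u}. \<forall>y\<in>{p, t}. x \<noteq> y \<and> \<not> x \<sqsubset> y \<and> \<not> y \<sqsubset> x"
    using st assms rk rank_less[of u p] rank_less[of p u] rank_less[of p s]
      rank_less[of t s] rank_less[of t u] by auto
  then have "\<forall>x\<in>{s, u}. \<forall>y\<in>{p, t}. incomparable r x y"
    using in_P incomparable_iff by auto
  then show False
    using av22 assms(1,2) unfolding avoids_chain_sum_def contains_2_2_iff by blast
qed

text \<open>Distinct elements of equal rank are incomparable, so a configuration excluded by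
  grade-avoidance is itself a (2 + 2).\<close>

lemma grade_avoids: "grade_avoids_2_0_plus_2_0 P r"
  unfolding grade_avoids_iff
proof
  assume "\<exists>a b c d. rk a = rk c \<and> rk b = rk a + 1 \<and> rk d = rk a + 1 \<and>
        a \<sqsubset> b \<and> c \<sqsubset> d \<and> \<not> a \<sqsubset> d \<and> \<not> c \<sqsubset> b"
  then obtain a b c d where *: "rk a = rk c" "rk b = rk a + 1" "rk d = rk a + 1"
    "a \<sqsubset> b" "c \<sqsubset> d" "\<not> a \<sqsubset> d" "\<not> c \<sqsubset> b" by blast
  have "a \<in> P" "b \<in> P" using * less_in by blast+
  moreover have "\<forall>x\<in>{a, b}. \<forall>y\<in>{c, d}. x \<noteq> y \<and> \<not> x \<sqsubset> y \<and> \<not> y \<sqsubset> x"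
    using * rank_less[of a c] rank_less[of c a] rank_less[of b d] rank_less[of d b]
      rank_less[of d a] rank_less[of b c] by auto
  ultimately have "\<forall>x\<in>{a, b}. \<forall>y\<in>{c, d}. incomparable r x y" using incomparable_iff by auto
  then show False
    using av22 *(4,5) unfolding avoids_chain_sum_def contains_2_2_iff by blast
qed

text \<open>Suppose \<open>p\<close> misses \<open>t\<close> above and \<open>s\<close> below. If
  \<open>s\<close> is below \<open>t\<close>, an element between them in the rank of
  \<open>p\<close> gives a three-element chain incomparable to \<open>p\<close>. Otherwise some
  \<open>u\<close> above \<open>s\<close> and \<open>v\<close> below \<open>t\<close>, both in the
  rank of \<open>p\<close>, give a (2 + 2).\<close>

lemma sees:
  assumes p: "p \<in> P"
  shows "up_seeing P r p \<or> down_seeing P r p"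
proof (rule ccontr)
  assume "\<not> ?thesis"
  then obtain s t where t: "t \<in> P" "rk t = rk p + 1" "\<not> p \<sqsubset> t"
    and s: "s \<in> P" "rk p = rk s + 1" "\<not> s \<sqsubset> p"
    unfolding up_seeing_iff down_seeing_iff by blast
  show False
  proof (cases "s \<sqsubset> t")
    case True
    then obtain m where m: "s \<sqsubset> m" "m \<sqsubset> t" "rk m = rk s + 1"
      by (rule ex_between) (use s t in simp)
    have "\<forall>x\<in>{s, m, t}. x \<noteq> p \<and> \<not> x \<sqsubset> p \<and> \<not> p \<sqsubset> x"
      using s t m rank_less[of t p] rank_less[of p s] rank_less[of p m] rank_less[of m p] by auto
    then have "\<forall>x\<in>{s, m, t}. incomparable r x p"
      using incomparable_iff m s(1) t(1) less_in by auto
    then show False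
      using av31 m p unfolding avoids_chain_sum_def contains_3_1_iff by blast
  next
    case False
    obtain u where u: "s \<sqsubset> u" "rk u = rk p" using ex_next_rank[of s p] s p by auto
    obtain v where v: "v \<sqsubset> t" "rk v = rk p" using ex_rank_below[of t "rk p"] t by auto
    show False using no_2_2_across[OF u(1) v(1)] u v False less_trans by auto
  qed
qed

lemma ex_all_seeing:
  assumes x: "x \<in> P"
  shows "\<exists>p\<in>P. rk p = rk x \<and> all_seeing P r p"
proof (rule ccontr)
  assume none: "\<not> ?thesis"
  let ?U = "{p \<in> P. rk p = rk x \<and> up_seeing P r p}"
  let ?D = "{p \<in> P. rk p = rk x \<and> down_seeing P r p}"
  obtain p where p: "p \<in> ?U" and pmax: "\<And>m. m \<in> ?U \<Longrightarrow> DS r m \<subseteq> DS r p"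
    by (rule finite_chain_greatest[of ?U "DS r"])
      (use fin DS_chain[OF grade_avoids] ex_up_seeing[OF grade_avoids x] in auto)
  obtain q where q: "q \<in> ?D" and qmax: "\<And>m. m \<in> ?D \<Longrightarrow> US r m \<subseteq> US r q"
    by (rule finite_chain_greatest[of ?D "US r"])
      (use fin US_chain[OF grade_avoids] ex_down_seeing[OF grade_avoids x] in auto)
  obtain s where s: "s \<in> P" "rk p = rk s + 1" "\<not> s \<sqsubset> p"
    using none p unfolding all_seeing_def down_seeing_iff by blast
  obtain t where t: "t \<in> P" "rk t = rk q + 1" "\<not> q \<sqsubset> t"
    using none q unfolding all_seeing_def up_seeing_iff by blast
  have pq: "rk q = rk p" using p q by simp
  have "s \<sqsubset> q" using q p s unfolding down_seeing_iff by auto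
  moreover have "p \<sqsubset> t" using p q t unfolding up_seeing_iff by auto
  ultimately have "s \<sqsubset> t" using no_2_2_across[OF _ _ pq s(3) t(3)] by blast
  then obtain m where m: "s \<sqsubset> m" "m \<sqsubset> t" "rk m = rk s + 1"
    by (rule ex_between) (use s t p q in auto)
  have "m \<in> P" "rk m = rk x" using m less_in s p by auto
  \<comment> \<open>Either case contradicts a maximal choice: an up-seeing \<open>m\<close> has
    \<open>s\<close> in \<open>DS r m\<close> but not in \<open>DS r p\<close>, and a down-seeing
    \<open>m\<close> has \<open>t\<close> in \<open>US r m\<close> but not in
    \<open>US r q\<close>.\<close>
  then have "m \<in> ?U \<or> m \<in> ?D" using sees by blast
  moreover have "s \<in> DS r m" "s \<notin> DS r p" using m s unfolding DS_def covers_iff by auto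
  moreover have "t \<in> US r m" "t \<notin> US r q"
    using m s t p q unfolding US_def covers_iff by auto
  ultimately show False using pmax qmax by blast
qed

end

end

theorem theorem5p4:
  fixes P :: "'a set" and r :: "'a rel"
  assumes "finite P" and "partial_order_on P r" and "graded P r"
  shows "avoids_chain_sum P r [3, 1] \<and> avoids_chain_sum P r [2, 2] \<longleftrightarrow>
    grade_avoids_2_0_plus_2_0 P r \<and>
    (\<forall>p \<in> P. up_seeing P r p \<or> down_seeing P r p) \<and>
    (\<forall>i. rank_set P r i \<noteq> {} \<longrightarrow> (\<exists>p \<in> rank_set P r i. all_seeing P r p))"
    (is "?avoids \<longleftrightarrow> ?conditions")
proof -
  interpret finite_graded_poset P r using assms by unfold_locales
  show ?thesis
  proof
    assume av: ?avoids
    have "\<exists>p \<in> rank_set P r i. all_seeing P r p" if nonempty: "rank_set P r i \<noteq> {}" for i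
    proof -
      \<comment> \<open>Nonemptiness makes the integer \<open>i\<close> the rank of an actual
        element.\<close>
      obtain x where "x \<in> P" "int (rk x) = i" using nonempty unfolding rank_set_def by blast
      then show ?thesis using ex_all_seeing av unfolding rank_set_def by force
    qed
    then show ?conditions using av grade_avoids sees by blast
  next
    assume ?conditions
    then show ?avoids using avoids_if_conditions by blast
  qed
qed

end
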